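(* Let $$f(\zeta,u)=C\,u^{-2}\log\zeta+g\,u^{-2}\zeta,$$ where $C\neq0$ is a complex constant and $g=g(u)$ is a complex-valued function (class $\mathrm{BL}_{13}$). For the corresponding vacuum pp-wave the following are equivalent: (i) $d\alpha\wedge d\nu=0$; (ii) $Y=0$; (iii) $g=0$.
   Context: Setting. Everything is local, on a small connected coordinate domain (with $\zeta\neq0$, $u\ne0$) with coordinates $(\zeta,\zeta^*,u,v)$, $\zeta$ complex, $u,v$ real; $^*$ (or a bar) is complex conjugation. A (non-flat) vacuum pp-wave is a metric $ds^2=2\,d\zeta\,d\bar\zeta-2\,du\,dv-2(f+\bar f)\,du^2$ with $f=f(\zeta,u)$ complex analytic in $\zeta$, smooth in $u$, $f_{\zeta\zeta}\neq0$ everywhere. Equalities are meant identically on the domain. Normalized tetrad and scalars. Let $a=\tfrac14\log f_{\zeta\zeta}$ and $\alpha=e^{a-a^*}(a_\zeta)^*$ (which is nowhere zero here). Write $\zeta=Z(a,u)$, $L=\log Z_a$ (functions of $(a,u)$), and let $\omega^1=(\alpha^* )^{-1}da=e^{a-a^*}(d\zeta-Z_u\,du)$, $\omega^2=(\omega^1)^*$, $\omega^3=e^{a+a^*}du$, $\omega^4=e^{-a-a^*}\big((f+f^*+Z_uZ_u^* )du+dv-Z_u\,d\zeta^*-Z_u^*\,d\zeta\big)$, so the metric is $2\omega^1\omega^2-2\omega^3\omega^4$. Its dual frame $(\delta,\delta^*,\Delta,D)$ is the null tetrad normalized by $\Psi_4=1$, $\gamma=0$ (Newman–Penrose notation). On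 functions of $(a,a^*,u)$: $\delta Q=\alpha^*Q_a$, $\delta^*Q=\alpha Q_{a^*}$, $\Delta Q=e^{-a-a^*}Q_u$ ($a,a^*$ fixed), $DQ=0$. The remaining spin coefficients are $\mu=e^{-a-a^*}L_u$ and $\nu=e^{-a-3a^*}(Z_{uu}+(f_\zeta)^* )$. Invariants: $A=\delta^*\alpha/\alpha^2$ and $Y=(3-A)\nu-1/\alpha+(\Delta\mu+\mu^2)/\alpha^*$. *)

theory Defs
  imports "HOL-Complex_Analysis.Complex_Analysis"
begin

text \<open>
  Coordinates \<open>(\<zeta>, u, v)\<close> range over \<open>complex \<times> real \<times> real\<close>, viewed as a real four-dimensional
  space; the coordinate \<open>\<zeta>\<^sup>*\<close> is \<open>cnj \<zeta>\<close>.  A tangent vector is a triple of the same type, whose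
  components are its values under \<open>d\<zeta>\<close>, \<open>du\<close>, \<open>dv\<close>.
\<close>

type_synonym point = "complex \<times> real \<times> real"

definition coordinate_domain :: "point set \<Rightarrow> bool" where
  "coordinate_domain M \<longleftrightarrow>
     open M \<and> connected M \<and> M \<noteq> {} \<and> (\<forall>(\<zeta>, u, v)\<in>M. \<zeta> \<noteq> 0 \<and> u \<noteq> 0)"

definition base :: "point set \<Rightarrow> (complex \<times> real) set" where
  "base M = (\<lambda>(\<zeta>, u, v). (\<zeta>, u)) ` M"

definition pderiv_u :: "('b \<Rightarrow> real \<Rightarrow> complex) \<Rightarrow> 'b \<Rightarrow> real \<Rightarrow> complex" where
  "pderiv_u F x u = vector_derivative (\<lambda>t. F x t) (at u)"

definition pderiv_c :: "(complex \<Rightarrow> real \<Rightarrow> complex) \<Rightarrow> complex \<Rightarrow> real \<Rightarrow> complex" where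
  "pderiv_c F z u = deriv (\<lambda>w. F w u) z"

definition smooth_on_open :: "real set \<Rightarrow> (real \<Rightarrow> complex) \<Rightarrow> bool" where
  "smooth_on_open I h \<longleftrightarrow>
     (\<forall>n. \<forall>x\<in>I. ((\<lambda>k y. vector_derivative k (at y)) ^^ n) h differentiable (at x))"

definition vacuum_pp_wave :: "point set \<Rightarrow> (complex \<Rightarrow> real \<Rightarrow> complex) \<Rightarrow> bool" where
  "vacuum_pp_wave M f \<longleftrightarrow>
     (\<forall>u. (\<lambda>\<zeta>. f \<zeta> u) holomorphic_on {\<zeta>. (\<zeta>, u) \<in> base M}) \<and>
     (\<forall>\<zeta>. smooth_on_open {u. (\<zeta>, u) \<in> base M} (f \<zeta>)) \<and>
     (\<forall>(\<zeta>, u)\<in>base M. pderiv_c (pderiv_c f) \<zeta> u \<noteq> 0)"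

text \<open>The metric, as a quadratic form on tangent vectors.\<close>

definition line_element :: "(complex \<Rightarrow> real \<Rightarrow> complex) \<Rightarrow> point \<Rightarrow> point \<Rightarrow> complex" where
  "line_element f = (\<lambda>(\<zeta>, u, v) (d\<zeta>, du, dv).
     2 * d\<zeta> * cnj d\<zeta> - 2 * of_real du * of_real dv
       - 2 * (f \<zeta> u + cnj (f \<zeta> u)) * (of_real du)\<^sup>2)"

text \<open>
  The inverse function \<open>\<zeta> = Z(a, u)\<close>, for a given branch \<open>a\<close> of \<open>(1/4) log f\<^sub>\<zeta>\<^sub>\<zeta>\<close>.
\<close>

definition Z_fun :: "point set \<Rightarrow> (complex \<Rightarrow> real \<Rightarrow> complex) \<Rightarrow> complex \<Rightarrow> real \<Rightarrow> complex" where
  "Z_fun M a b u = the_inv_into {\<zeta>. (\<zeta>, u) \<in> base M} (\<lambda>\<zeta>. a \<zeta> u) b"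

text \<open>
  \<open>a\<close> and \<open>L\<close> are continuous branches of \<open>(1/4) log f\<^sub>\<zeta>\<^sub>\<zeta>\<close> on the domain and of \<open>log Z\<^sub>a\<close> on its image
  in the \<open>(a, u)\<close>-space; injectivity makes \<open>(a, u)\<close> usable in place of \<open>(\<zeta>, u)\<close>.  These conditions
  are what the smallness of the domain provides.
\<close>

definition adapted_branches ::
  "point set \<Rightarrow> (complex \<Rightarrow> real \<Rightarrow> complex) \<Rightarrow> (complex \<Rightarrow> real \<Rightarrow> complex)
     \<Rightarrow> (complex \<Rightarrow> real \<Rightarrow> complex) \<Rightarrow> bool" where
  "adapted_branches M f a L \<longleftrightarrow>
     continuous_on (base M) (\<lambda>(\<zeta>, u). a \<zeta> u) \<and>
     (\<forall>(\<zeta>, u)\<in>base M. exp (4 * a \<zeta> u) = pderiv_c (pderiv_c f) \<zeta> u) \<and>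
     inj_on (\<lambda>(\<zeta>, u). (a \<zeta> u, u)) (base M) \<and>
     continuous_on ((\<lambda>(\<zeta>, u). (a \<zeta> u, u)) ` base M) (\<lambda>(b, u). L b u) \<and>
     (\<forall>(\<zeta>, u)\<in>base M. exp (L (a \<zeta> u) u) = pderiv_c (Z_fun M a) (a \<zeta> u) u)"

definition coframe1 ::
  "point set \<Rightarrow> (complex \<Rightarrow> real \<Rightarrow> complex) \<Rightarrow> point \<Rightarrow> point \<Rightarrow> complex" where
  "coframe1 M a = (\<lambda>(\<zeta>, u, v) (d\<zeta>, du, dv).
     exp (a \<zeta> u - cnj (a \<zeta> u)) * (d\<zeta> - pderiv_u (Z_fun M a) (a \<zeta> u) u * of_real du))"

definition coframe2 ::
  "point set \<Rightarrow> (complex \<Rightarrow> real \<Rightarrow> complex) \<Rightarrow> point \<Rightarrow> point \<Rightarrow> complex" where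
  "coframe2 M a p X = cnj (coframe1 M a p X)"

definition coframe3 :: "(complex \<Rightarrow> real \<Rightarrow> complex) \<Rightarrow> point \<Rightarrow> point \<Rightarrow> complex" where
  "coframe3 a = (\<lambda>(\<zeta>, u, v) (d\<zeta>, du, dv). exp (a \<zeta> u + cnj (a \<zeta> u)) * of_real du)"

definition coframe4 ::
  "point set \<Rightarrow> (complex \<Rightarrow> real \<Rightarrow> complex) \<Rightarrow> (complex \<Rightarrow> real \<Rightarrow> complex)
     \<Rightarrow> point \<Rightarrow> point \<Rightarrow> complex" where
  "coframe4 M f a = (\<lambda>(\<zeta>, u, v) (d\<zeta>, du, dv).
     let Zu = pderiv_u (Z_fun M a) (a \<zeta> u) u in
     exp (- a \<zeta> u - cnj (a \<zeta> u)) *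
       ((f \<zeta> u + cnj (f \<zeta> u) + Zu * cnj Zu) * of_real du + of_real dv
          - Zu * cnj d\<zeta> - cnj Zu * d\<zeta>))"

lemma line_element_coframe:
  "line_element f p X =
     2 * coframe1 M a p X * coframe2 M a p X - 2 * coframe3 a p X * coframe4 M f a p X"
proof (cases p; cases X)
  fix \<zeta> u v d\<zeta> du dv
  assume p: "p = (\<zeta>, u, v)" and X: "X = (d\<zeta>, du, dv)"
  define w where "w = pderiv_u (Z_fun M a) (a \<zeta> u) u"
  define E where "E = exp (a \<zeta> u - cnj (a \<zeta> u))"
  define F where "F = exp (a \<zeta> u + cnj (a \<zeta> u))"
  have E: "E * cnj E = 1"
    by (simp add: E_def exp_cnj flip: exp_add)
  have F: "F * exp (- a \<zeta> u - cnj (a \<zeta> u)) = 1"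
    by (simp add: F_def flip: exp_add)
  have 12: "coframe1 M a p X * coframe2 M a p X
      = (E * cnj E) * ((d\<zeta> - w * of_real du) * (cnj d\<zeta> - cnj w * of_real du))"
    by (simp add: coframe1_def coframe2_def p X w_def E_def mult_ac)
  have 34: "coframe3 a p X * coframe4 M f a p X
      = (F * exp (- a \<zeta> u - cnj (a \<zeta> u))) * (of_real du *
          ((f \<zeta> u + cnj (f \<zeta> u) + w * cnj w) * of_real du + of_real dv
            - w * cnj d\<zeta> - cnj w * d\<zeta>))"
    by (simp add: coframe3_def coframe4_def p X w_def F_def Let_def mult_ac)
  show ?thesis
    unfolding mult.assoc 12 34 E F
    by (simp add: line_element_def p X algebra_simps power2_eq_square)
qed

text \<open>
  The action of the dual frame \<open>(\<delta>, \<delta>\<^sup>*, \<Delta>, D)\<close> on a function \<open>Q\<close>, i.e. the coefficients in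
  \<open>dQ = (\<delta>Q) \<omega>\<^sup>1 + (\<delta>\<^sup>*Q) \<omega>\<^sup>2 + (\<Delta>Q) \<omega>\<^sup>3 + (DQ) \<omega>\<^sup>4\<close>.
\<close>

definition frame_derivs ::
  "point set \<Rightarrow> (complex \<Rightarrow> real \<Rightarrow> complex) \<Rightarrow> (complex \<Rightarrow> real \<Rightarrow> complex)
     \<Rightarrow> (point \<Rightarrow> complex) \<Rightarrow> point \<Rightarrow> complex \<times> complex \<times> complex \<times> complex" where
  "frame_derivs M f a Q p = (THE (c1, c2, c3, c4). \<forall>X.
     frechet_derivative Q (at p) X =
       c1 * coframe1 M a p X + c2 * coframe2 M a p X + c3 * coframe3 a p X + c4 * coframe4 M f a p X)"

definition frame_delta_star ::
  "point set \<Rightarrow> (complex \<Rightarrow> real \<Rightarrow> complex) \<Rightarrow> (complex \<Rightarrow> real \<Rightarrow> complex)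
     \<Rightarrow> (point \<Rightarrow> complex) \<Rightarrow> point \<Rightarrow> complex" where
  "frame_delta_star M f a Q p = (case frame_derivs M f a Q p of (c1, c2, c3, c4) \<Rightarrow> c2)"

definition frame_Delta ::
  "point set \<Rightarrow> (complex \<Rightarrow> real \<Rightarrow> complex) \<Rightarrow> (complex \<Rightarrow> real \<Rightarrow> complex)
     \<Rightarrow> (point \<Rightarrow> complex) \<Rightarrow> point \<Rightarrow> complex" where
  "frame_Delta M f a Q p = (case frame_derivs M f a Q p of (c1, c2, c3, c4) \<Rightarrow> c3)"

definition spin_alpha :: "(complex \<Rightarrow> real \<Rightarrow> complex) \<Rightarrow> point \<Rightarrow> complex" where
  "spin_alpha a = (\<lambda>(\<zeta>, u, v). exp (a \<zeta> u - cnj (a \<zeta> u)) * cnj (pderiv_c a \<zeta> u))"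

definition spin_mu ::
  "(complex \<Rightarrow> real \<Rightarrow> complex) \<Rightarrow> (complex \<Rightarrow> real \<Rightarrow> complex) \<Rightarrow> point \<Rightarrow> complex" where
  "spin_mu a L = (\<lambda>(\<zeta>, u, v). exp (- a \<zeta> u - cnj (a \<zeta> u)) * pderiv_u L (a \<zeta> u) u)"

definition spin_nu ::
  "point set \<Rightarrow> (complex \<Rightarrow> real \<Rightarrow> complex) \<Rightarrow> (complex \<Rightarrow> real \<Rightarrow> complex)
     \<Rightarrow> point \<Rightarrow> complex" where
  "spin_nu M f a = (\<lambda>(\<zeta>, u, v). exp (- a \<zeta> u - 3 * cnj (a \<zeta> u)) *
     (pderiv_u (pderiv_u (Z_fun M a)) (a \<zeta> u) u + cnj (pderiv_c f \<zeta> u)))"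

definition inv_A ::
  "point set \<Rightarrow> (complex \<Rightarrow> real \<Rightarrow> complex) \<Rightarrow> (complex \<Rightarrow> real \<Rightarrow> complex)
     \<Rightarrow> point \<Rightarrow> complex" where
  "inv_A M f a p = frame_delta_star M f a (spin_alpha a) p / (spin_alpha a p)\<^sup>2"

definition inv_Y ::
  "point set \<Rightarrow> (complex \<Rightarrow> real \<Rightarrow> complex) \<Rightarrow> (complex \<Rightarrow> real \<Rightarrow> complex)
     \<Rightarrow> (complex \<Rightarrow> real \<Rightarrow> complex) \<Rightarrow> point \<Rightarrow> complex" where
  "inv_Y M f a L p =
     (3 - inv_A M f a p) * spin_nu M f a p - 1 / spin_alpha a p
       + (frame_Delta M f a (spin_mu a L) p + (spin_mu a L p)\<^sup>2) / cnj (spin_alpha a p)"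

definition wedge_d ::
  "(point \<Rightarrow> complex) \<Rightarrow> (point \<Rightarrow> complex) \<Rightarrow> point \<Rightarrow> point \<Rightarrow> point \<Rightarrow> complex" where
  "wedge_d P Q p X Y =
     frechet_derivative P (at p) X * frechet_derivative Q (at p) Y
       - frechet_derivative P (at p) Y * frechet_derivative Q (at p) X"

definition log_branch :: "complex set \<Rightarrow> (complex \<Rightarrow> complex) \<Rightarrow> bool" where
  "log_branch S lg \<longleftrightarrow> lg holomorphic_on S \<and> (\<forall>\<zeta>\<in>S. exp (lg \<zeta>) = \<zeta>)"

definition BL13 ::
  "(complex \<Rightarrow> complex) \<Rightarrow> complex \<Rightarrow> (real \<Rightarrow> complex) \<Rightarrow> complex \<Rightarrow> real \<Rightarrow> complex" where
  "BL13 lg C g \<zeta> u = C / (of_real u)\<^sup>2 * lg \<zeta> + g u / (of_real u)\<^sup>2 * \<zeta>"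

end

theory Submission
  imports Defs
begin

text \<open>
  For \<open>BL\<^sub>1\<^sub>3\<close> one has \<open>e\<^sup>4\<^sup>a = - C / (u\<zeta>)\<^sup>2\<close>, so on the connected domain \<open>e\<^sup>2\<^sup>a = \<kappa> / (u\<zeta>)\<close> for a constant
  \<open>\<kappa>\<close> with \<open>\<kappa>\<^sup>2 = - C\<close>, whence \<open>Z(b, u) = \<kappa> e\<^sup>-\<^sup>2\<^sup>b / u\<close> and \<open>L\<^sub>u = - 1 / u\<close>.  Writing \<open>r = |\<zeta>|\<close>,
  \<open>k = sgn \<kappa>\<close> and \<open>s = sgn u\<close>, the scalars become explicit: \<open>\<alpha> = - k s / (2 r)\<close>, \<open>\<mu> = - s r / |\<kappa>|\<close> and
  \<open>\<nu> = (k s / |C|) (2 r\<^sup>3 + C\<^sup>* r + \<zeta>\<^sup>* r g\<^sup>*)\<close>.  Hence \<open>A = 1\<close>, and everything in \<open>Y\<close> cancels except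
  \<open>(2 k s / |C|) r \<zeta>\<^sup>* g\<^sup>*\<close>.  Since \<open>\<alpha>\<close> is a function of \<open>r\<close>, \<open>d\<alpha> \<and> d\<nu>\<close> vanishes iff \<open>\<nu>\<close> is locally a
  function of \<open>r\<close> as well; rotating \<open>\<zeta>\<close> at fixed \<open>u\<close> shows that this forces \<open>g = 0\<close>.
\<close>

section \<open>Continuous logarithms and their derivatives\<close>

lemma eventually_nhds_of_isCont:
  assumes "isCont f x" "eventually P (nhds (f x))"
  shows "eventually (\<lambda>y. P (f y)) (nhds x)"
proof -
  have "filterlim f (nhds (f x)) (nhds x)"
    using assms(1) by (simp add: isCont_def tendsto_at_iff_tendsto_nhds)
  with assms(2) show ?thesis by (rule eventually_compose_filterlim)
qed

text \<open>A continuous logarithm is locally a translate of the principal branch, hence differentiable.\<close>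

lemma isCont_eq_Ln_exp:
  fixes h :: "'a::t2_space \<Rightarrow> complex"
  assumes "isCont h x"
  shows "eventually (\<lambda>y. h y = h x + Ln (exp (h y) / exp (h x))) (nhds x)"
proof -
  \<comment> \<open>Radius \<open>pi\<close> confines \<open>h y - h x\<close> to the strip on which
    \<open>Ln\<close> inverts \<open>exp\<close>.\<close>
  have "eventually (\<lambda>w. w \<in> ball (h x) pi) (nhds (h x))"
    by (rule eventually_nhds_in_open) auto
  from eventually_nhds_of_isCont[OF assms this]
  show ?thesis
  proof eventually_elim
    case (elim y)
    have "\<bar>Im (h y - h x)\<bar> < pi"
      using elim abs_Im_le_cmod[of "h y - h x"] by (simp add: dist_norm norm_minus_commute)
    then have "Ln (exp (h y - h x)) = h y - h x"
      by (intro Ln_exp) auto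
    then show ?case by (simp add: exp_diff)
  qed
qed

lemma has_field_derivative_transform_nhds:
  assumes "(f has_field_derivative D) (at x)" "eventually (\<lambda>y. f y = g y) (nhds x)"
  shows "(g has_field_derivative D) (at x)"
  using assms DERIV_cong_ev[OF refl assms(2) refl] by blast

text \<open>The exponentials of the branches are explicit although the branches are not; the chain
  rule for \<open>Ln\<close> at 1 transfers the derivative from \<open>exp h\<close> to
  \<open>h\<close>.\<close>

lemma has_field_derivative_log:
  fixes h :: "complex \<Rightarrow> complex"
  assumes "isCont h z" "((\<lambda>w. exp (h w)) has_field_derivative D) (at z)"
  shows "(h has_field_derivative D / exp (h z)) (at z)"
proof -
  have "(Ln has_field_derivative 1) (at (exp (h z) / exp (h z)))"
    by (auto intro!: derivative_eq_intros)
  from DERIV_chain2[OF this DERIV_cdivide[OF assms(2)]]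
  have "((\<lambda>w. Ln (exp (h w) / exp (h z))) has_field_derivative D / exp (h z)) (at z)"
    by simp
  from DERIV_add[OF DERIV_const[of "h z"] this]
  have "((\<lambda>w. h z + Ln (exp (h w) / exp (h z))) has_field_derivative D / exp (h z)) (at z)"
    by simp
  with isCont_eq_Ln_exp[OF assms(1)] show ?thesis
    using DERIV_cong_ev[OF refl isCont_eq_Ln_exp[OF assms(1)] refl] by blast
qed

lemma has_vector_derivative_transform_nhds:
  assumes "(f has_vector_derivative D) (at x)" "eventually (\<lambda>y. f y = g y) (nhds x)"
  shows "(g has_vector_derivative D) (at x)"
  using has_vector_derivative_cong_ev[of UNIV f g x D] assms eventually_nhds_x_imp_x[OF assms(2)]
  by simp

lemma has_vector_derivative_log:
  fixes h :: "real \<Rightarrow> complex"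
  assumes "isCont h t" "((\<lambda>s. exp (h s)) has_vector_derivative D) (at t)"
  shows "(h has_vector_derivative D / exp (h t)) (at t)"
proof -
  have "((Ln \<circ> (\<lambda>s. exp (h s) / exp (h t))) has_vector_derivative (D / exp (h t)) * 1) (at t)"
    by (rule field_vector_diff_chain_at)
       (use has_vector_derivative_divide[OF assms(2), of "exp (h t)"] in \<open>auto intro!: derivative_eq_intros\<close>)
  then have "((\<lambda>s. h t + Ln (exp (h s) / exp (h t))) has_vector_derivative D / exp (h t)) (at t)"
    by (auto simp: o_def intro!: derivative_eq_intros)
  moreover have "eventually (\<lambda>y. h t + Ln (exp (h y) / exp (h t)) = h y) (nhds t)"
    using isCont_eq_Ln_exp[OF assms(1)] by eventually_elim simp
  ultimately show ?thesis
    by (rule has_vector_derivative_transform_nhds)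
qed

text \<open>For fixed \<open>b\<close>, both \<open>Z b u\<close> and \<open>exp (L b u)\<close> are
  constants divided by \<open>u\<close>; the two clauses serve their first and second derivatives in
  \<open>u\<close>.\<close>

lemma has_vector_derivative_divide_of_real:
  fixes K :: complex
  assumes "t \<noteq> 0"
  shows "((\<lambda>s. K / of_real s) has_vector_derivative - K / (of_real t)\<^sup>2) (at t)"
    and "((\<lambda>s. K / (of_real s)\<^sup>2) has_vector_derivative - 2 * K / (of_real t) ^ 3) (at t)"
proof -
  have r: "(of_real has_vector_derivative 1) (at t)"
    using has_vector_derivative_of_real[OF DERIV_ident[of "at t"]] by simp
  have "((\<lambda>w. K / w) has_field_derivative - K / (of_real t)\<^sup>2) (at (of_real t))"
    using assms by (auto intro!: derivative_eq_intros simp: power2_eq_square)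
  from field_vector_diff_chain_at[OF r this]
  show "((\<lambda>s. K / of_real s) has_vector_derivative - K / (of_real t)\<^sup>2) (at t)"
    by (simp add: o_def)
  have "((\<lambda>w. K / w\<^sup>2) has_field_derivative - 2 * K / (of_real t)^3) (at (of_real t))"
    using assms by (auto intro!: derivative_eq_intros simp: field_simps power2_eq_square power3_eq_cube)
  from field_vector_diff_chain_at[OF r this]
  show "((\<lambda>s. K / (of_real s)\<^sup>2) has_vector_derivative - 2 * K / (of_real t) ^ 3) (at t)"
    by (simp add: o_def)
qed

section \<open>The projected domain and radial functions\<close>

lemma open_base: "open M \<Longrightarrow> open (base M)"
proof -
  assume "open M"
  have "base M = (\<Union>v. (\<lambda>(\<zeta>, u). (\<zeta>, u, v)) -` M)"
    by (force simp: base_def)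
  also have "open \<dots>"
    unfolding case_prod_unfold by (intro open_UN ballI open_vimage \<open>open M\<close> continuous_intros)
  finally show ?thesis .
qed

text \<open>Turns the derivative of the norm into a combination of \<open>w\<close> and
  \<open>cnj w\<close>, so that coframe coefficients can be read off. At \<open>z = 0\<close> both
  sides are 0, by \<open>sgn 0 = 0\<close> and division by zero.\<close>

lemma of_real_inner_sgn:
  "complex_of_real (w \<bullet> sgn z) = (cnj z * w + z * cnj w) / (2 * of_real (cmod z))"
  by (cases "z = 0")
     (auto simp: complex_eq_iff inner_complex_def sgn_div_norm scaleR_conv_of_real field_simps Re_divide_of_real Im_divide_of_real)

lemma sgn_unimodular: "\<kappa> \<noteq> 0 \<Longrightarrow> sgn \<kappa> * cnj (sgn \<kappa>) = 1" for \<kappa> :: complex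
  by (simp add: complex_norm_square[symmetric] norm_sgn)

lemma has_derivative_of_real_cmod_fst:
  assumes "\<zeta> \<noteq> 0"
  shows "((\<lambda>x. complex_of_real (cmod (fst x))) has_derivative (\<lambda>X. of_real (fst X \<bullet> sgn \<zeta>)))
    (at (\<zeta>, y))"
proof -
  have "(norm has_derivative (\<lambda>h. h \<bullet> sgn \<zeta>)) (at (fst (\<zeta>, y)))"
    using has_derivative_norm[OF assms] by simp
  from has_derivative_compose[OF has_derivative_fst[OF has_derivative_ident] this]
  show ?thesis by (intro has_derivative_of_real) simp
qed

text \<open>The profile \<open>h\<close> is a complex function, evaluated at the real number
  \<open>cmod \<zeta>\<close>, so that complex differentiation rules apply to it.\<close>

lemma has_derivative_radial:
  assumes "\<zeta> \<noteq> 0" "(h has_field_derivative D) (at (complex_of_real (cmod \<zeta>)))"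
  shows "((\<lambda>x. h (of_real (cmod (fst x)))) has_derivative (\<lambda>X. D * of_real (fst X \<bullet> sgn \<zeta>)))
    (at (\<zeta>, y))"
  using has_derivative_compose[OF has_derivative_of_real_cmod_fst[OF assms(1)],
      of h "(*) D" y] assms(2)
  by (simp add: has_field_derivative_def)

section \<open>The wave: its domain and the derivatives of \<open>f\<close>\<close>

locale BL13_wave =
  fixes M :: "point set" and C :: complex and g :: "real \<Rightarrow> complex"
    and lg :: "complex \<Rightarrow> complex" and a L :: "complex \<Rightarrow> real \<Rightarrow> complex"
  assumes dom: "coordinate_domain M"
    and C: "C \<noteq> 0"
    and lg: "log_branch (fst ` M) lg"
    and wave: "vacuum_pp_wave M (BL13 lg C g)"
    and branches: "adapted_branches M (BL13 lg C g) a L"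
begin

abbreviation B where "B \<equiv> base M"
abbreviation f where "f \<equiv> BL13 lg C g"
abbreviation Z where "Z \<equiv> Z_fun M a"
text \<open>The image of the domain in (a, u)-space, where \<open>Z\<close> and \<open>L\<close> are
  differentiated.\<close>

definition W where "W = (\<lambda>(\<zeta>, u). (a \<zeta> u, u)) ` B"

lemma open_M: "open M" and open_B: "open B" and connected_B: "connected B" and B_ne: "B \<noteq> {}"
proof -
  show "open M" "B \<noteq> {}" using dom by (auto simp: coordinate_domain_def base_def)
  then show "open B" by (simp add: open_base)
  show "connected B" unfolding base_def case_prod_unfold
    using dom by (intro connected_continuous_image continuous_intros) (auto simp: coordinate_domain_def)
qed

lemma base_D: assumes "(\<zeta>, u) \<in> B" shows "\<zeta> \<noteq> 0" "u \<noteq> 0" "\<zeta> \<in> fst ` M"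
proof -
  obtain v where v: "(\<zeta>, u, v) \<in> M"
    using assms by (auto simp: base_def)
  then show "\<zeta> \<noteq> 0" "u \<noteq> 0"
    using dom by (auto simp: coordinate_domain_def)
  show "\<zeta> \<in> fst ` M" using v by (force intro: rev_image_eqI)
qed

lemma base_I: "(\<zeta>, u, v) \<in> M \<Longrightarrow> (\<zeta>, u) \<in> B"
  by (force simp: base_def)

lemma slices:
  assumes "(\<zeta>, u) \<in> B"
  shows "eventually (\<lambda>w. (w, u) \<in> B) (nhds \<zeta>)" "eventually (\<lambda>t. (\<zeta>, t) \<in> B) (nhds u)"
  by (rule eventually_nhds_of_isCont[where P = "\<lambda>x. x \<in> B"], intro continuous_intros,
      rule eventually_nhds_in_open[OF open_B assms])+

lemma lg_deriv:
  assumes "\<zeta> \<in> fst ` M" "\<zeta> \<noteq> 0"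
  shows "(lg has_field_derivative 1 / \<zeta>) (at \<zeta>)"
proof -
  have o: "open (fst ` M)" by (rule open_image_fst[OF open_M])
  have h: "lg holomorphic_on fst ` M" and e: "\<And>z. z \<in> fst ` M \<Longrightarrow> exp (lg z) = z"
    using lg by (auto simp: log_branch_def)
  have "isCont lg \<zeta>"
    using continuous_on_eq_continuous_at[OF o] holomorphic_on_imp_continuous_on[OF h] assms by blast
  moreover have "((\<lambda>w. exp (lg w)) has_field_derivative 1) (at \<zeta>)"
    using DERIV_ident[of "at \<zeta>"]
    by (rule has_field_derivative_transform_within_open[OF _ o assms(1)]) (simp add: e)
  ultimately show ?thesis
    using has_field_derivative_log[of \<zeta> lg 1] e[OF assms(1)] by simp
qed

lemma f_\<zeta>:
  assumes "(\<zeta>, u) \<in> B"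
  shows "pderiv_c f \<zeta> u = C / (of_real u)\<^sup>2 / \<zeta> + g u / (of_real u)\<^sup>2"
proof -
  have "((\<lambda>w. c * lg w + d * w) has_field_derivative c / \<zeta> + d) (at \<zeta>)" for c d
    using DERIV_add[OF DERIV_cmult[OF lg_deriv] DERIV_cmult[OF DERIV_ident]] base_D[OF assms] by simp
  then show ?thesis
    unfolding pderiv_c_def BL13_def by (intro DERIV_imp_deriv)
qed

text \<open>The \<open>g\<close>-term is linear in \<zeta> and drops out, so of the spin
  coefficients only \<nu>, through \<open>pderiv_c f\<close>, sees \<open>g\<close>.\<close>

lemma f_\<zeta>\<zeta>:
  assumes "(\<zeta>, u) \<in> B"
  shows "pderiv_c (pderiv_c f) \<zeta> u = - C / (of_real u)\<^sup>2 / \<zeta>\<^sup>2"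
proof -
  have "((\<lambda>w. c / w + d) has_field_derivative - c / \<zeta>\<^sup>2) (at \<zeta>)" for c d
    using base_D[OF assms] by (auto intro!: derivative_eq_intros simp: power2_eq_square)
  note this[of "C / (of_real u)\<^sup>2" "g u / (of_real u)\<^sup>2"]
  moreover have "eventually (\<lambda>w. pderiv_c f w u = C / (of_real u)\<^sup>2 / w + g u / (of_real u)\<^sup>2) (nhds \<zeta>)"
    using slices(1)[OF assms] by eventually_elim (rule f_\<zeta>)
  ultimately show ?thesis
    unfolding pderiv_c_def[of "pderiv_c f"] by (simp add: deriv_cong_ev DERIV_imp_deriv)
qed

lemma a_cont: "continuous_on B (\<lambda>(\<zeta>, u). a \<zeta> u)"
  and exp_4a: "(\<zeta>, u) \<in> B \<Longrightarrow> exp (4 * a \<zeta> u) = - C / (of_real u)\<^sup>2 / \<zeta>\<^sup>2"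
  and L_cont: "continuous_on W (\<lambda>(b, u). L b u)"
  and exp_L': "(\<zeta>, u) \<in> B \<Longrightarrow> exp (L (a \<zeta> u) u) = pderiv_c Z (a \<zeta> u) u"
proof -
  note br = branches[unfolded adapted_branches_def, folded W_def]
  show "continuous_on B (\<lambda>(\<zeta>, u). a \<zeta> u)" "continuous_on W (\<lambda>(b, u). L b u)"
    using br by simp_all
  show "exp (4 * a \<zeta> u) = - C / (of_real u)\<^sup>2 / \<zeta>\<^sup>2"
    and "exp (L (a \<zeta> u) u) = pderiv_c Z (a \<zeta> u) u" if "(\<zeta>, u) \<in> B"
    using br that f_\<zeta>\<zeta>[OF that] by fastforce+
qed

lemma Z_a: assumes "(\<zeta>, u) \<in> B" shows "Z (a \<zeta> u) u = \<zeta>"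
proof -
  have "inj_on (\<lambda>(\<zeta>, u). (a \<zeta> u, u)) B"
    using branches by (simp add: adapted_branches_def)
  from inj_onD[OF this] have "inj_on (\<lambda>\<zeta>. a \<zeta> u) {\<zeta>. (\<zeta>, u) \<in> B}"
    by (intro inj_onI) auto
  then show ?thesis
    unfolding Z_fun_def using assms by (intro the_inv_into_f_f) auto
qed

section \<open>The constant \<kappa> and the derivative of the branch \<open>a\<close>\<close>

text \<open>The square of \<open>\<zeta> * of_real u * exp (2 * a \<zeta> u)\<close> is
  \<open>- C\<close>, so this continuous function takes at most two values and is constant on the
  connected base.\<close>

lemma ex_\<kappa>: "\<exists>\<kappa>. \<forall>(\<zeta>, u)\<in>B. exp (2 * a \<zeta> u) = \<kappa> / (\<zeta> * of_real u)"
proof -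
  define k where "k = (\<lambda>(\<zeta>, u). \<zeta> * of_real u * exp (2 * a \<zeta> u))"
  have sq: "(k x)\<^sup>2 = - C" if "x \<in> B" for x
  proof (cases x)
    case (Pair \<zeta> u)
    then have "(k x)\<^sup>2 = \<zeta>\<^sup>2 * (of_real u)\<^sup>2 * exp (4 * a \<zeta> u)"
      by (simp add: k_def power_mult_distrib flip: exp_double)
    then show ?thesis
      using exp_4a[of \<zeta> u] base_D[of \<zeta> u] that Pair by simp
  qed
  have "continuous_on B k"
    using a_cont unfolding k_def case_prod_unfold by (intro continuous_intros)
  moreover have "finite (k ` B)"
  proof (rule finite_subset)
    show "k ` B \<subseteq> {csqrt (- C), - csqrt (- C)}"
    proof
      fix y assume "y \<in> k ` B"
      then have "y\<^sup>2 = (csqrt (- C))\<^sup>2" using sq by auto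
      then show "y \<in> {csqrt (- C), - csqrt (- C)}" by (simp only: power2_eq_iff insert_iff empty_iff) simp
    qed
  qed simp
  ultimately obtain \<kappa> where \<kappa>: "\<And>x. x \<in> B \<Longrightarrow> k x = \<kappa>"
    using continuous_finite_range_constant[OF connected_B, of k] B_ne
    by (metis constant_on_def)
  then have "exp (2 * a \<zeta> u) = \<kappa> / (\<zeta> * of_real u)" if "(\<zeta>, u) \<in> B" for \<zeta> u
  proof -
    have "k (\<zeta>, u) = \<kappa>" by (rule \<kappa>[OF that])
    then show ?thesis using base_D[OF that] by (simp add: k_def field_simps)
  qed
  then show ?thesis by blast
qed

text \<open>Since \<open>B\<close> is nonempty the chosen constant is unique: the branch
  \<open>a\<close> decides which square root of \<open>- C\<close> it is.\<close>

definition \<kappa> where "\<kappa> = (SOME \<kappa>. \<forall>(\<zeta>, u)\<in>B. exp (2 * a \<zeta> u) = \<kappa> / (\<zeta> * of_real u))"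

lemma exp_2a: "(\<zeta>, u) \<in> B \<Longrightarrow> exp (2 * a \<zeta> u) = \<kappa> / (\<zeta> * of_real u)"
  using someI_ex[OF ex_\<kappa>] unfolding \<kappa>_def by blast

lemma \<kappa>_sq: "\<kappa>\<^sup>2 = - C" and \<kappa>_nz: "\<kappa> \<noteq> 0"
proof -
  obtain \<zeta> u where B: "(\<zeta>, u) \<in> B" using B_ne by auto
  have "exp (4 * a \<zeta> u) = (exp (2 * a \<zeta> u))\<^sup>2"
    by (simp flip: exp_double)
  then show "\<kappa>\<^sup>2 = - C"
    using exp_4a[OF B] exp_2a[OF B] base_D[OF B] by (simp add: field_simps power2_eq_square)
  then show "\<kappa> \<noteq> 0" using C by auto
qed

lemma norm_\<kappa>_sq: "cmod \<kappa> * cmod \<kappa> = cmod C"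
  by (metis \<kappa>_sq norm_minus_cancel norm_mult power2_eq_square)

lemma a_isCont: "(\<zeta>, u) \<in> B \<Longrightarrow> isCont (\<lambda>(\<zeta>, u). a \<zeta> u) (\<zeta>, u)"
  using a_cont continuous_on_eq_continuous_at[OF open_B] by blast

lemma a_\<zeta>:
  assumes "(\<zeta>, u) \<in> B"
  shows "pderiv_c a \<zeta> u = - 1 / (2 * \<zeta>)"
proof -
  note [simp] = base_D[OF assms] \<kappa>_nz
  have "((\<lambda>w. \<kappa> / (w * of_real u)) has_field_derivative - \<kappa> / (\<zeta>\<^sup>2 * of_real u)) (at \<zeta>)"
    by (auto intro!: derivative_eq_intros simp: power2_eq_square)
  moreover have "eventually (\<lambda>w. \<kappa> / (w * of_real u) = exp (2 * a w u)) (nhds \<zeta>)"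
    using slices(1)[OF assms] by eventually_elim (simp add: exp_2a)
  ultimately have d: "((\<lambda>w. exp (2 * a w u)) has_field_derivative - \<kappa> / (\<zeta>\<^sup>2 * of_real u)) (at \<zeta>)"
    by (rule has_field_derivative_transform_nhds)
  have "isCont (\<lambda>w. a w u) \<zeta>"
    using isCont_o2[of \<zeta> "\<lambda>w. (w, u)" "\<lambda>(\<zeta>, u). a \<zeta> u"] a_isCont[OF assms] by simp
  \<comment> \<open>It is \<open>exp (2 * a)\<close>, not \<open>exp a\<close>, that is explicit;
    hence \<open>2 * a\<close> is differentiated and the result halved.\<close>
  then have "isCont (\<lambda>w. 2 * a w u) \<zeta>" by (intro continuous_intros)
  from has_field_derivative_log[OF this d]
  have "((\<lambda>w. 2 * a w u) has_field_derivative - 1 / \<zeta>) (at \<zeta>)"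
    by (simp add: exp_2a[OF assms] power2_eq_square)
  from DERIV_cdivide[OF this, of 2] show ?thesis
    unfolding pderiv_c_def by (intro DERIV_imp_deriv) (simp add: mult.commute)
qed

section \<open>The inverse function \<open>Z\<close> and the branch \<open>L\<close> on (a,
  u)-space\<close>

text \<open>
  The inverse map is given explicitly by \<open>\<Phi>\<close>; near the base point the ambiguity of \<open>a\<close> in
  multiples of \<open>\<i>\<pi>\<close> is excluded by continuity.
\<close>

lemma ev_W:
  assumes "(\<zeta>, u) \<in> B"
  shows "eventually (\<lambda>x. x \<in> W) (nhds (a \<zeta> u, u))"
proof -
  note [simp] = base_D[OF assms] \<kappa>_nz
  define \<Phi> where "\<Phi> = (\<lambda>x. (\<kappa> * exp (- 2 * fst x) / of_real (snd x), snd x))"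
  \<comment> \<open>\<open>h\<close> vanishes at the base point, and wherever \<Phi> lands in
    \<open>B\<close> its value is a multiple of \<i>\<pi>; modulus below \<pi> therefore forces the
    value 0.\<close>
  define h where "h = (\<lambda>x. case_prod a (\<Phi> x) - fst x)"
  let ?x = "(a \<zeta> u, u)"
  have c: "isCont \<Phi> ?x"
    unfolding \<Phi>_def by (intro continuous_intros) simp
  have v: "\<Phi> ?x = (\<zeta>, u)"
    using exp_2a[OF assms] by (simp add: \<Phi>_def exp_minus field_simps)
  have 1: "eventually (\<lambda>x. \<Phi> x \<in> B) (nhds ?x)"
    using eventually_nhds_in_open[OF open_B assms] by (intro eventually_nhds_of_isCont[OF c]) (simp add: v)
  have "isCont (\<lambda>x. case_prod a (\<Phi> x)) ?x"
    by (rule isCont_o2[OF c]) (use a_isCont[OF assms] v in simp)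
  then have "isCont h ?x" unfolding h_def by (intro continuous_intros)
  moreover have "eventually (\<lambda>w. w \<in> ball 0 pi) (nhds (h ?x))"
    by (rule eventually_nhds_in_open) (auto simp: h_def v)
  ultimately have "eventually (\<lambda>x. h x \<in> ball 0 pi) (nhds ?x)"
    by (rule eventually_nhds_of_isCont)
  with 1 show ?thesis
  proof eventually_elim
    case (elim x)
    obtain b t where x: "x = (b, t)" by force
    define z where "z = \<kappa> * exp (- 2 * b) / of_real t"
    have zt: "(z, t) \<in> B" using elim(1) by (simp add: \<Phi>_def x z_def)
    have "exp (2 * a z t) = exp (2 * b)"
      using exp_2a[OF zt] base_D[OF zt] by (simp add: z_def exp_minus field_simps)
    then have "exp (2 * (a z t - b)) = 1"
      by (simp add: right_diff_distrib exp_diff)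
    moreover have "cmod (a z t - b) < pi"
      using elim(2) by (simp add: h_def \<Phi>_def x z_def)
    then have "\<bar>Im (2 * (a z t - b))\<bar> < 2 * pi"
      using abs_Im_le_cmod[of "a z t - b"] by simp
    ultimately have "2 * (a z t - b) = 0"
      by (intro exp_complex_eqI[of _ 0, simplified]) auto
    then have "x = (a z t, t)" by (simp add: x)
    then show ?case
      unfolding W_def using zt by (intro image_eqI[of _ _ "(z, t)"]) auto
  qed
qed

lemma Z_W: assumes "(b, t) \<in> W" shows "Z b t = \<kappa> * exp (- 2 * b) / of_real t" "t \<noteq> 0"
proof -
  obtain \<zeta> where \<zeta>: "(\<zeta>, t) \<in> B" "b = a \<zeta> t" using assms by (auto simp: W_def)
  show "t \<noteq> 0" using base_D[OF \<zeta>(1)] by simp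
  show "Z b t = \<kappa> * exp (- 2 * b) / of_real t"
    using exp_2a[OF \<zeta>(1)] base_D[OF \<zeta>(1)] \<kappa>_nz by (simp add: Z_a \<zeta> exp_minus field_simps)
qed

text \<open>Makes it legitimate to vary \<open>u\<close> with \<open>b\<close> fixed, and
  \<open>b\<close> with \<open>u\<close> fixed.\<close>

lemma open_W: "open W"
proof (subst open_subopen, intro ballI)
  fix x assume "x \<in> W"
  then have "eventually (\<lambda>x. x \<in> W) (nhds x)"
    using ev_W by (auto simp: W_def)
  then show "\<exists>T. open T \<and> x \<in> T \<and> T \<subseteq> W"
    unfolding eventually_nhds by blast
qed

lemma slices_W:
  assumes "(b, u) \<in> W"
  shows "eventually (\<lambda>w. (w, u) \<in> W) (nhds b)" "eventually (\<lambda>t. (b, t) \<in> W) (nhds u)"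
  by (rule eventually_nhds_of_isCont[where P = "\<lambda>x. x \<in> W"], intro continuous_intros,
      rule eventually_nhds_in_open[OF open_W assms])+

lemma Z_u:
  assumes "(b, u) \<in> W"
  shows "pderiv_u Z b u = - (\<kappa> * exp (- 2 * b)) / (of_real u)\<^sup>2"
proof -
  have ev: "eventually (\<lambda>t. \<kappa> * exp (- 2 * b) / of_real t = Z b t) (nhds u)"
    using slices_W(2)[OF assms] by eventually_elim (simp add: Z_W)
  show ?thesis
    unfolding pderiv_u_def
    using has_vector_derivative_transform_nhds[OF has_vector_derivative_divide_of_real(1)[OF Z_W(2)[OF assms]] ev]
    by (intro vector_derivative_at) simp
qed

lemma Z_uu:
  assumes "(b, u) \<in> W"
  shows "pderiv_u (pderiv_u Z) b u = 2 * (\<kappa> * exp (- 2 * b)) / (of_real u) ^ 3"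
proof -
  have ev: "eventually (\<lambda>t. - (\<kappa> * exp (- 2 * b)) / (of_real t)\<^sup>2 = pderiv_u Z b t) (nhds u)"
    using slices_W(2)[OF assms] by eventually_elim (simp add: Z_u)
  show ?thesis
    unfolding pderiv_u_def[of "pderiv_u Z"]
    using has_vector_derivative_transform_nhds[OF has_vector_derivative_divide_of_real(2)[OF Z_W(2)[OF assms]] ev]
    by (intro vector_derivative_at) simp
qed

lemma Z_b:
  assumes "(b, u) \<in> W"
  shows "pderiv_c Z b u = - 2 * \<kappa> * exp (- 2 * b) / of_real u"
proof -
  have "((\<lambda>w. \<kappa> * exp (- 2 * w) / of_real u) has_field_derivative
      - 2 * \<kappa> * exp (- 2 * b) / of_real u) (at b)"
    using Z_W(2)[OF assms] by (auto intro!: derivative_eq_intros)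
  moreover have "eventually (\<lambda>w. Z w u = \<kappa> * exp (- 2 * w) / of_real u) (nhds b)"
    using slices_W(1)[OF assms] by eventually_elim (simp add: Z_W)
  ultimately show ?thesis
    unfolding pderiv_c_def by (simp add: deriv_cong_ev DERIV_imp_deriv)
qed

lemma exp_L: "(b, u) \<in> W \<Longrightarrow> exp (L b u) = - 2 * \<kappa> * exp (- 2 * b) / of_real u"
  using Z_b[of b u] exp_L' by (auto simp: W_def)

lemma L_u:
  assumes "(b, u) \<in> W"
  shows "pderiv_u L b u = - 1 / of_real u"
proof -
  \<comment> \<open>For fixed \<open>b\<close> this factor is constant and cancels in the
    logarithmic derivative, which is why \<open>L_u\<close> depends on \<open>u\<close>
    alone.\<close>
  let ?K = "- 2 * \<kappa> * exp (- 2 * b)"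
  have ev: "eventually (\<lambda>t. ?K / of_real t = exp (L b t)) (nhds u)"
    using slices_W(2)[OF assms] by eventually_elim (simp add: exp_L)
  have d: "((\<lambda>t. exp (L b t)) has_vector_derivative - ?K / (of_real u)\<^sup>2) (at u)"
    by (rule has_vector_derivative_transform_nhds[OF has_vector_derivative_divide_of_real(1)[OF Z_W(2)[OF assms]] ev])
  have "isCont (\<lambda>(b, u). L b u) (b, u)"
    using L_cont continuous_on_eq_continuous_at[OF open_W] assms by blast
  then have "isCont (\<lambda>t. L b t) u"
    using isCont_o2[of u "\<lambda>t. (b, t)" "\<lambda>(b, u). L b u"] by simp
  from has_vector_derivative_log[OF this d] show ?thesis
    unfolding pderiv_u_def using exp_L[OF assms] Z_W(2)[OF assms] \<kappa>_nz
    by (intro vector_derivative_at) (simp add: power2_eq_square)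
qed

section \<open>Explicit spin coefficients\<close>

text \<open>The left side is the squared modulus of \<open>exp a\<close>, that is, the modulus of
  the explicit \<open>exp (2 * a)\<close>.\<close>

lemma exp_a_plus_cnj:
  assumes "(\<zeta>, u) \<in> B"
  shows "exp (a \<zeta> u + cnj (a \<zeta> u)) = of_real (cmod \<kappa> / (cmod \<zeta> * \<bar>u\<bar>))"
proof -
  have "exp (a \<zeta> u + cnj (a \<zeta> u)) = of_real ((cmod (exp (a \<zeta> u)))\<^sup>2)"
    by (simp only: exp_add exp_cnj complex_norm_square)
  also have "(cmod (exp (a \<zeta> u)))\<^sup>2 = cmod (exp (2 * a \<zeta> u))"
    by (simp only: norm_power exp_double)
  finally show ?thesis
    by (simp only: exp_2a[OF assms] norm_divide norm_mult norm_of_real)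
qed

lemma exp_a_minus_cnj:
  assumes "(\<zeta>, u) \<in> B"
  shows "exp (a \<zeta> u - cnj (a \<zeta> u)) = sgn \<kappa> * of_real (sgn u) * of_real (cmod \<zeta>) / \<zeta>"
proof -
  have "exp (a \<zeta> u - cnj (a \<zeta> u)) = exp (2 * a \<zeta> u) / exp (a \<zeta> u + cnj (a \<zeta> u))"
    by (simp flip: exp_diff)
  also have "\<dots> = \<kappa> / (\<zeta> * of_real u) / of_real (cmod \<kappa> / (cmod \<zeta> * \<bar>u\<bar>))"
    by (simp only: exp_a_plus_cnj[OF assms] exp_2a[OF assms])
  also have "\<dots> = sgn \<kappa> * of_real (sgn u) * of_real (cmod \<zeta>) / \<zeta>"
    using base_D[OF assms] by (cases "u > 0") (auto simp: sgn_eq field_simps)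
  finally show ?thesis .
qed

lemma Z_u_a: "(\<zeta>, u) \<in> B \<Longrightarrow> pderiv_u Z (a \<zeta> u) u = - \<zeta> / of_real u"
  and Z_uu_a: "(\<zeta>, u) \<in> B \<Longrightarrow> pderiv_u (pderiv_u Z) (a \<zeta> u) u = 2 * \<zeta> / (of_real u)\<^sup>2"
  and L_u_a: "(\<zeta>, u) \<in> B \<Longrightarrow> pderiv_u L (a \<zeta> u) u = - 1 / of_real u"
proof -
  assume B: "(\<zeta>, u) \<in> B"
  then have W: "(a \<zeta> u, u) \<in> W" by (force simp: W_def)
  \<comment> \<open>This substitution carries the formulas in (a, u) back to the coordinates
    (\<zeta>, u).\<close>
  have e: "\<kappa> * exp (- 2 * a \<zeta> u) = \<zeta> * of_real u"
    using base_D[OF B] \<kappa>_nz by (simp add: exp_minus exp_2a[OF B])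
  show "pderiv_u Z (a \<zeta> u) u = - \<zeta> / of_real u"
    using base_D[OF B] unfolding Z_u[OF W] e by (simp add: power2_eq_square)
  show "pderiv_u (pderiv_u Z) (a \<zeta> u) u = 2 * \<zeta> / (of_real u)\<^sup>2"
    using base_D[OF B] unfolding Z_uu[OF W] e by (simp add: power2_eq_square power3_eq_cube)
  show "pderiv_u L (a \<zeta> u) u = - 1 / of_real u"
    by (rule L_u[OF W])
qed

text \<open>The phase of \<open>cmod \<zeta> / \<zeta>\<close> in \<open>exp_a_minus_cnj\<close>
  cancels that of \<open>1 / cnj \<zeta>\<close> in the conjugate of \<open>a_\<zeta>\<close>,
  leaving a function of the modulus and of the sign of \<open>u\<close>.\<close>

lemma spin_alpha_eq:
  assumes "(\<zeta>, u, v) \<in> M"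
  shows "spin_alpha a (\<zeta>, u, v) = - (sgn \<kappa> * of_real (sgn u)) / (2 * of_real (cmod \<zeta>))"
proof -
  note B = base_I[OF assms]
  have "\<zeta> * cnj \<zeta> = of_real (cmod \<zeta>) * of_real (cmod \<zeta>)"
    by (simp add: complex_norm_square[symmetric] power2_eq_square)
  then show ?thesis
    using base_D[OF B] by (simp add: spin_alpha_def exp_a_minus_cnj[OF B] a_\<zeta>[OF B] field_simps)
qed

lemma spin_mu_eq:
  assumes "(\<zeta>, u, v) \<in> M"
  shows "spin_mu a L (\<zeta>, u, v) = - of_real (sgn u / cmod \<kappa>) * of_real (cmod \<zeta>)"
proof -
  note B = base_I[OF assms]
  have "exp (- a \<zeta> u - cnj (a \<zeta> u)) = inverse (exp (a \<zeta> u + cnj (a \<zeta> u)))"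
    by (simp flip: exp_minus)
  then show ?thesis
    using base_D[OF B] \<kappa>_nz
    by (cases "u > 0") (auto simp: spin_mu_def exp_a_plus_cnj[OF B] L_u_a[OF B] field_simps)
qed

lemma spin_nu_eq:
  assumes "(\<zeta>, u, v) \<in> M"
  shows "spin_nu M f a (\<zeta>, u, v) = sgn \<kappa> * of_real (sgn u / cmod C) *
    (2 * of_real (cmod \<zeta>) ^ 3 + cnj C * of_real (cmod \<zeta>) + cnj \<zeta> * of_real (cmod \<zeta>) * cnj (g u))"
proof -
  note B = base_I[OF assms]
  define r where "r = complex_of_real (cmod \<zeta>)"
  have rr: "\<zeta> * cnj \<zeta> = r\<^sup>2"
    by (simp add: r_def flip: complex_norm_square)
  have nz: "\<zeta> \<noteq> 0" "cnj \<zeta> \<noteq> 0" "r \<noteq> 0" "u \<noteq> 0" using base_D[OF B] by (auto simp: r_def)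
  let ?E = "exp (a \<zeta> u - cnj (a \<zeta> u))" and ?F = "exp (a \<zeta> u + cnj (a \<zeta> u))"
  have F: "?F\<^sup>2 = of_real (cmod C) / (r\<^sup>2 * (of_real u)\<^sup>2)"
    unfolding exp_a_plus_cnj[OF B]
    by (simp add: r_def power_divide power_mult_distrib flip: norm_\<kappa>_sq of_real_power)
       (simp add: power2_eq_square)
  \<comment> \<open>The exponent is split so that only the two known exponentials \<open>?E\<close>
    and \<open>?F\<close> occur.\<close>
  have "- a \<zeta> u - 3 * cnj (a \<zeta> u) = (a \<zeta> u - cnj (a \<zeta> u)) - 2 * (a \<zeta> u + cnj (a \<zeta> u))"
    by simp
  then have "exp (- a \<zeta> u - 3 * cnj (a \<zeta> u)) = ?E / ?F\<^sup>2"
    by (simp only: exp_diff exp_double)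
  also have "\<dots> = sgn \<kappa> * of_real (sgn u / cmod C) * (of_real u)\<^sup>2 * (r ^ 3 / \<zeta>)"
    unfolding F exp_a_minus_cnj[OF B] r_def[symmetric]
    using nz by (simp add: field_simps power2_eq_square power3_eq_cube)
  finally have e: "exp (- a \<zeta> u - 3 * cnj (a \<zeta> u)) = \<dots>" .
  have "spin_nu M f a (\<zeta>, u, v) = exp (- a \<zeta> u - 3 * cnj (a \<zeta> u)) *
      (2 * \<zeta> / (of_real u)\<^sup>2 + cnj (C / (of_real u)\<^sup>2 / \<zeta> + g u / (of_real u)\<^sup>2))"
    by (simp only: spin_nu_def prod.case Z_uu_a[OF B] f_\<zeta>[OF B])
  also have "\<dots> = sgn \<kappa> * of_real (sgn u / cmod C) *
      (2 * r ^ 3 + cnj C * (r ^ 3 / (\<zeta> * cnj \<zeta>)) + (r ^ 3 / \<zeta>) * cnj (g u))"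
  proof -
    \<comment> \<open>Here \<open>V\<close> stands for the square of \<open>u\<close>: the
      exponential carries \<open>V\<close> and both summands carry \<open>1 / V\<close>, so
      \<open>u\<close> survives only through its sign and \<open>g u\<close>.\<close>
    have "k * V * (q / \<zeta>) * (2 * \<zeta> / V + (c / V / cnj \<zeta> + h / V))
        = k * (2 * q + c * (q / (\<zeta> * cnj \<zeta>)) + (q / \<zeta>) * h)" if "V \<noteq> 0" for k V q c h
      using that nz by (simp add: field_simps)
    then show ?thesis
      unfolding e complex_cnj_add complex_cnj_divide complex_cnj_power complex_cnj_complex_of_real
      by this (use nz in simp)
  qed
  also have "r ^ 3 / (\<zeta> * cnj \<zeta>) = r"
    unfolding rr using nz by (simp add: power2_eq_square power3_eq_cube)
  also have "r ^ 3 / \<zeta> = cnj \<zeta> * r"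
    using nz rr by (simp add: field_simps power2_eq_square power3_eq_cube)
  finally show ?thesis by (simp add: r_def)
qed

section \<open>The dual frame on radial functions\<close>

text \<open>Gives the uniqueness behind the \<open>THE\<close> in \<open>frame_derivs\<close>. Only
  the fourth coframe form sees \<open>dv\<close>; once it is removed, the directions 1 and \<i>
  separate the first two forms, and \<open>du\<close> isolates the third.\<close>

lemma coframe_independent:
  assumes p: "(\<zeta>, u, v) \<in> M"
    and 0: "\<And>X. c1 * coframe1 M a (\<zeta>, u, v) X + c2 * coframe2 M a (\<zeta>, u, v) X
      + c3 * coframe3 a (\<zeta>, u, v) X + c4 * coframe4 M f a (\<zeta>, u, v) X = 0"
  shows "c1 = 0 \<and> c2 = 0 \<and> c3 = 0 \<and> c4 = 0"
proof -
  have c4: "c4 = 0"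
    using 0[of "(0, 0, 1)"]
    by (simp add: coframe1_def coframe2_def coframe3_def coframe4_def)
  let ?E = "exp (a \<zeta> u - cnj (a \<zeta> u))"
  have "c1 * ?E + c2 * cnj ?E = 0" "c1 * ?E - c2 * cnj ?E = 0"
    using 0[of "(1, 0, 0)"] 0[of "(\<i>, 0, 0)"]
    by (simp_all add: c4 coframe1_def coframe2_def coframe3_def algebra_simps)
  then have "c1 * ?E = 0" "c2 * cnj ?E = 0"
    by algebra+
  then have 12: "c1 = 0" "c2 = 0" by simp_all
  have "c3 = 0"
    using 0[of "(0, 1, 0)"] by (simp add: c4 12 coframe3_def)
  with c4 12 show ?thesis by simp
qed

text \<open>The differential of \<open>r = cmod \<zeta>\<close> is
  \<open>(cnj \<zeta> * d\<zeta> + \<zeta> * cnj d\<zeta>) / (2 * r)\<close>. Expressing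
  \<open>d\<zeta>\<close> by the first form uses that \<open>E\<close> is unimodular and that
  \<open>Z_u\<close> is \<open>- \<zeta> / u\<close>; the latter produces the coefficient of the
  third form.\<close>

lemma frame_derivs_radial:
  assumes p: "(\<zeta>, u, v) \<in> M"
    and Q: "(Q has_derivative (\<lambda>X. K * of_real (fst X \<bullet> sgn \<zeta>))) (at (\<zeta>, u, v))"
  defines "E \<equiv> exp (a \<zeta> u - cnj (a \<zeta> u))" and "F \<equiv> exp (a \<zeta> u + cnj (a \<zeta> u))"
  shows "frame_derivs M f a Q (\<zeta>, u, v) =
    (K * cnj \<zeta> * cnj E / (2 * of_real (cmod \<zeta>)), K * \<zeta> * E / (2 * of_real (cmod \<zeta>)),
      - K * of_real (cmod \<zeta>) / (of_real u * F), 0)"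
proof -
  note B = base_I[OF p]
  define r where "r = complex_of_real (cmod \<zeta>)"
  have rr: "\<zeta> * cnj \<zeta> = r\<^sup>2"
    by (simp add: r_def flip: complex_norm_square)
  have nz: "r \<noteq> 0" "u \<noteq> 0" using base_D[OF B] by (auto simp: r_def)
  have EE: "E * cnj E = 1"
    by (simp add: E_def exp_cnj flip: exp_add)
  have F: "F \<noteq> 0" by (simp add: F_def)
  let ?c1 = "K * cnj \<zeta> * cnj E / (2 * r)" and ?c2 = "K * \<zeta> * E / (2 * r)"
    and ?c3 = "- K * r / (of_real u * F)"
  have dQ: "frechet_derivative Q (at (\<zeta>, u, v)) X = K * of_real (fst X \<bullet> sgn \<zeta>)" for X
    using frechet_derivative_at[OF Q] by metis
  have ex: "frechet_derivative Q (at (\<zeta>, u, v)) X = ?c1 * coframe1 M a (\<zeta>, u, v) X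
      + ?c2 * coframe2 M a (\<zeta>, u, v) X + ?c3 * coframe3 a (\<zeta>, u, v) X
      + 0 * coframe4 M f a (\<zeta>, u, v) X" for X
  proof (cases X)
    fix d\<zeta> du dv assume X: "X = (d\<zeta>, du, dv)"
    have 1: "coframe1 M a (\<zeta>, u, v) X = E * (d\<zeta> + \<zeta> / of_real u * of_real du)"
      by (simp add: coframe1_def X Z_u_a[OF B] E_def)
    have "?c1 * coframe1 M a (\<zeta>, u, v) X + ?c2 * coframe2 M a (\<zeta>, u, v) X
      = K / (2 * r) * (E * cnj E) * (cnj \<zeta> * (d\<zeta> + \<zeta> / of_real u * of_real du)
          + \<zeta> * (cnj d\<zeta> + cnj \<zeta> / of_real u * of_real du))"
      unfolding coframe2_def 1 by (simp add: algebra_simps add_divide_distrib)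
    also have "\<dots> = K / (2 * r) * (cnj \<zeta> * d\<zeta> + \<zeta> * cnj d\<zeta>
        + 2 * (\<zeta> * cnj \<zeta>) / of_real u * of_real du)"
      unfolding EE by (simp add: algebra_simps)
    also have "\<dots> = K * ((cnj \<zeta> * d\<zeta> + \<zeta> * cnj d\<zeta>) / (2 * r)) + K * r / of_real u * of_real du"
      unfolding rr using nz by (simp add: field_simps power2_eq_square)
    finally show ?thesis
      using F by (simp add: dQ of_real_inner_sgn X r_def[symmetric] coframe3_def F_def[symmetric])
  qed
  show ?thesis
    unfolding frame_derivs_def r_def[symmetric]
  proof (rule the_equality)
    show "case (?c1, ?c2, ?c3, 0) of (c1, c2, c3, c4) \<Rightarrow> \<forall>X.
       frechet_derivative Q (at (\<zeta>, u, v)) X = c1 * coframe1 M a (\<zeta>, u, v) X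
        + c2 * coframe2 M a (\<zeta>, u, v) X + c3 * coframe3 a (\<zeta>, u, v) X
        + c4 * coframe4 M f a (\<zeta>, u, v) X"
      unfolding prod.case using ex by blast
  next
    fix d :: "complex \<times> complex \<times> complex \<times> complex"
    obtain d1 d2 d3 d4 where d: "d = (d1, d2, d3, d4)" by (metis prod.exhaust)
    assume "case d of (c1, c2, c3, c4) \<Rightarrow> \<forall>X.
       frechet_derivative Q (at (\<zeta>, u, v)) X = c1 * coframe1 M a (\<zeta>, u, v) X
        + c2 * coframe2 M a (\<zeta>, u, v) X + c3 * coframe3 a (\<zeta>, u, v) X
        + c4 * coframe4 M f a (\<zeta>, u, v) X"
    then have d': "frechet_derivative Q (at (\<zeta>, u, v)) X = d1 * coframe1 M a (\<zeta>, u, v) X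
        + d2 * coframe2 M a (\<zeta>, u, v) X + d3 * coframe3 a (\<zeta>, u, v) X
        + d4 * coframe4 M f a (\<zeta>, u, v) X" for X
      unfolding d prod.case by blast
    have "d1 - ?c1 = 0 \<and> d2 - ?c2 = 0 \<and> d3 - ?c3 = 0 \<and> d4 - 0 = 0"
    proof (rule coframe_independent[OF p])
      fix X
      show "(d1 - ?c1) * coframe1 M a (\<zeta>, u, v) X + (d2 - ?c2) * coframe2 M a (\<zeta>, u, v) X
        + (d3 - ?c3) * coframe3 a (\<zeta>, u, v) X + (d4 - 0) * coframe4 M f a (\<zeta>, u, v) X = 0"
        using trans[OF d'[symmetric] ex, of X] by (simp only: left_diff_distrib) algebra
    qed
    then show "d = (?c1, ?c2, ?c3, 0)"
      unfolding d by (simp only: right_minus_eq)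
  qed
qed

section \<open>The invariants \<open>A\<close> and \<open>Y\<close>\<close>

text \<open>The sign of \<open>u\<close> is locally constant, so it may be held fixed when differentiating.\<close>

lemma has_derivative_cong_sgn:
  assumes "(F has_derivative F') (at (\<zeta>, u, v))" "(\<zeta>, u, v) \<in> M"
    and "\<And>z t w. (z, t, w) \<in> M \<Longrightarrow> sgn t = sgn u \<Longrightarrow> F (z, t, w) = Q (z, t, w)"
  shows "(Q has_derivative F') (at (\<zeta>, u, v))"
proof (rule has_derivative_transform_within_open[OF assms(1)])
  let ?S = "M \<inter> {x. fst (snd x) * u > 0}"
  show "open ?S"
    by (intro open_Int open_M open_Collect_less continuous_intros)
  show "(\<zeta>, u, v) \<in> ?S"
    using assms(2) base_D[OF base_I[OF assms(2)]] by (simp add: zero_less_mult_iff linorder_neq_iff disj_commute)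
  show "F x = Q x" if "x \<in> ?S" for x
    using that assms(3)[of "fst x" "fst (snd x)" "snd (snd x)"]
    by (auto simp: zero_less_mult_iff)
qed

lemma has_derivative_spin_alpha:
  assumes "(\<zeta>, u, v) \<in> M"
  shows "(spin_alpha a has_derivative (\<lambda>X. sgn \<kappa> * of_real (sgn u) / (2 * (of_real (cmod \<zeta>))\<^sup>2)
    * of_real (fst X \<bullet> sgn \<zeta>))) (at (\<zeta>, u, v))"
proof (rule has_derivative_cong_sgn[OF has_derivative_radial assms])
  show nz: "\<zeta> \<noteq> 0" using base_D[OF base_I[OF assms]] by simp
  have "((\<lambda>r. - k / (2 * r)) has_field_derivative k / (2 * (of_real (cmod \<zeta>))\<^sup>2))
      (at (of_real (cmod \<zeta>)))" for k :: complex
    using nz by (auto intro!: derivative_eq_intros simp: power2_eq_square)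
  then show "((\<lambda>r. - (sgn \<kappa> * of_real (sgn u)) / (2 * r)) has_field_derivative
      sgn \<kappa> * of_real (sgn u) / (2 * (of_real (cmod \<zeta>))\<^sup>2)) (at (of_real (cmod \<zeta>)))" .
qed (simp add: spin_alpha_eq)

lemma has_derivative_spin_mu:
  assumes "(\<zeta>, u, v) \<in> M"
  shows "(spin_mu a L has_derivative (\<lambda>X. - of_real (sgn u / cmod \<kappa>) * of_real (fst X \<bullet> sgn \<zeta>)))
    (at (\<zeta>, u, v))"
proof (rule has_derivative_cong_sgn[OF has_derivative_radial assms])
  show "\<zeta> \<noteq> 0" using base_D[OF base_I[OF assms]] by simp
  show "((\<lambda>r. - of_real (sgn u / cmod \<kappa>) * r) has_field_derivative
      - of_real (sgn u / cmod \<kappa>)) (at (of_real (cmod \<zeta>)))"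
    by (rule DERIV_cmult_Id)
qed (simp add: spin_mu_eq)

text \<open>With \<open>K\<close> the radial derivative of \<alpha>, the numerator is
  \<open>K * \<zeta> * E / (2 * r)\<close>. Since
  \<open>\<zeta> * E = sgn \<kappa> * sgn u * r\<close>, this equals the square of \<alpha>.\<close>

lemma inv_A_eq:
  assumes p: "(\<zeta>, u, v) \<in> M"
  shows "inv_A M f a (\<zeta>, u, v) = 1"
proof -
  have nz: "\<zeta> \<noteq> 0" "sgn u * sgn u = 1" using base_D[OF base_I[OF p]] by (auto simp: sgn_if)
  then have "complex_of_real (sgn u) * of_real (sgn u) = 1"
    by (metis of_real_1 of_real_mult)
  then show ?thesis
    using nz \<kappa>_nz
    by (simp add: inv_A_def frame_delta_star_def spin_alpha_eq[OF p] exp_a_minus_cnj[OF base_I[OF p]]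
        frame_derivs_radial[OF p has_derivative_spin_alpha[OF p]] field_simps power2_eq_square sgn_zero_iff)
qed

text \<open>The value is the square of \<mu>, so the last numerator in \<open>Y\<close> is twice
  that square.\<close>

lemma frame_Delta_spin_mu:
  assumes p: "(\<zeta>, u, v) \<in> M"
  shows "frame_Delta M f a (spin_mu a L) (\<zeta>, u, v) = of_real ((cmod \<zeta>)\<^sup>2 / cmod C)"
proof -
  have nz: "\<zeta> \<noteq> 0" "u \<noteq> 0" using base_D[OF base_I[OF p]] by auto
  have "frame_Delta M f a (spin_mu a L) (\<zeta>, u, v)
      = of_real (sgn u / cmod \<kappa> * cmod \<zeta> / (u * (cmod \<kappa> / (cmod \<zeta> * \<bar>u\<bar>))))"
    by (simp add: frame_Delta_def frame_derivs_radial[OF p has_derivative_spin_mu[OF p]]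
        exp_a_plus_cnj[OF base_I[OF p]])
  also have "sgn u / cmod \<kappa> * cmod \<zeta> / (u * (cmod \<kappa> / (cmod \<zeta> * \<bar>u\<bar>))) = (cmod \<zeta>)\<^sup>2 / cmod C"
    using nz by (simp add: power2_eq_square sgn_if flip: norm_\<kappa>_sq)
  finally show ?thesis .
qed

text \<open>As \<open>A = 1\<close>, \<nu> enters with factor 2. Its cubic term cancels against the
  \<mu>-terms and its linear term against \<open>- 1 / \<alpha>\<close>; only the
  \<open>g\<close>-term remains.\<close>

lemma inv_Y_eq:
  assumes p: "(\<zeta>, u, v) \<in> M"
  shows "inv_Y M f a L (\<zeta>, u, v) =
    2 * sgn \<kappa> * of_real (sgn u * cmod \<zeta> / cmod C) * cnj \<zeta> * cnj (g u)"
proof -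
  define r where "r = complex_of_real (cmod \<zeta>)"
  define s where "s = complex_of_real (sgn u)"
  define k where "k = sgn \<kappa>"
  define c where "c = complex_of_real (cmod C)"
  have nz: "r \<noteq> 0" "c \<noteq> 0" "u \<noteq> 0" using base_D[OF base_I[OF p]] C by (auto simp: r_def c_def)
  have k: "k * cnj k = 1" "k \<noteq> 0"
    using \<kappa>_nz by (simp_all add: k_def sgn_unimodular sgn_zero_iff)
  have s: "s * s = 1" "s \<noteq> 0" "cnj s = s" using nz by (auto simp: s_def sgn_if)
  \<comment> \<open>The phase of \<open>C\<close> is tied to that of \<kappa> by
    \<open>\<kappa>_sq\<close>; this relation is what cancels the linear terms.\<close>
  have kC: "k * cnj C = - c * cnj k"
  proof -
    have "\<kappa> = k * of_real (cmod \<kappa>)"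
      using \<kappa>_nz by (simp add: k_def sgn_eq)
    then have "cnj C = - (cnj k)\<^sup>2 * (of_real (cmod \<kappa>))\<^sup>2"
      using \<kappa>_sq by (metis complex_cnj_complex_of_real complex_cnj_minus complex_cnj_power
          minus_equation_iff mult_minus_left power_mult_distrib complex_cnj_mult)
    also have "(of_real (cmod \<kappa>))\<^sup>2 = c"
      by (simp add: c_def power2_eq_square flip: norm_\<kappa>_sq)
    finally show ?thesis
      using k by (simp add: power2_eq_square)
  qed
  have "k * (s * (s * cnj k)) = 1" using k(1) s(1) by algebra
  then have alpha: "1 / spin_alpha a (\<zeta>, u, v) = - 2 * r * s * cnj k"
    unfolding spin_alpha_eq[OF p] r_def[symmetric] s_def[symmetric] k_def[symmetric]
    using k s nz by (simp add: field_simps)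
  then have "1 / cnj (spin_alpha a (\<zeta>, u, v)) = - 2 * r * s * k"
    by (metis complex_cnj_cnj complex_cnj_divide complex_cnj_one complex_cnj_mult complex_cnj_minus
        complex_cnj_numeral s(3) r_def complex_cnj_complex_of_real)
  moreover have "(spin_mu a L (\<zeta>, u, v))\<^sup>2 = of_real ((cmod \<zeta>)\<^sup>2 / cmod C)"
    unfolding spin_mu_eq[OF p] using nz
    by (simp add: power_mult_distrib power_divide sgn_if flip: norm_\<kappa>_sq of_real_power)
       (simp add: power2_eq_square)
  then have mu: "frame_Delta M f a (spin_mu a L) (\<zeta>, u, v) + (spin_mu a L (\<zeta>, u, v))\<^sup>2 = 2 * r\<^sup>2 / c"
    unfolding frame_Delta_spin_mu[OF p] by (simp add: r_def c_def)
  ultimately have "(frame_Delta M f a (spin_mu a L) (\<zeta>, u, v) + (spin_mu a L (\<zeta>, u, v))\<^sup>2)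
      / cnj (spin_alpha a (\<zeta>, u, v)) = 2 * r\<^sup>2 / c * (- 2 * r * s * k)"
    by (metis mult.right_neutral times_divide_eq_right)
  then have "inv_Y M f a L (\<zeta>, u, v) =
      2 * (k * (s / c) * (2 * r ^ 3 + cnj C * r + cnj \<zeta> * r * cnj (g u)))
        - (- 2 * r * s * cnj k) + 2 * r\<^sup>2 / c * (- 2 * r * s * k)"
    by (simp add: inv_Y_def alpha inv_A_eq[OF p] spin_nu_eq[OF p] flip: r_def s_def k_def c_def)
  also have "\<dots> = 2 * s / c * r * (k * cnj C + c * cnj k) + 2 * k * (s * r / c) * cnj \<zeta> * cnj (g u)"
    using nz by (simp add: field_simps power2_eq_square power3_eq_cube)
  also have "k * cnj C + c * cnj k = 0" by (simp add: kC)
  finally show ?thesis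
    by (simp add: k_def s_def r_def c_def)
qed

lemma inv_Y_eq_0_iff:
  assumes "(\<zeta>, u, v) \<in> M"
  shows "inv_Y M f a L (\<zeta>, u, v) = 0 \<longleftrightarrow> g u = 0"
  using inv_Y_eq[OF assms] base_D[OF base_I[OF assms]] \<kappa>_nz C by (simp add: sgn_zero_iff)

section \<open>The wedge product of the differentials of \<alpha> and \<nu>\<close>

text \<open>Regularity of \<open>g\<close> is inherited from \<open>f\<close>: at fixed nonzero
  \<zeta> the formula for \<open>f\<close> is solved for \<open>g\<close>, and the case
  \<open>n = 0\<close> of smoothness in \<open>u\<close> applies.\<close>

lemma g_differentiable:
  assumes "(\<zeta>, u) \<in> B"
  shows "g differentiable at u"
proof -
  note nz = base_D[OF assms]
  have "smooth_on_open {u. (\<zeta>, u) \<in> B} (f \<zeta>)"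
    using wave unfolding vacuum_pp_wave_def by blast
  then have "f \<zeta> differentiable at u"
    unfolding smooth_on_open_def using assms by (metis funpow_0 mem_Collect_eq)
  then obtain D where D: "(f \<zeta> has_vector_derivative D) (at u)"
    by (auto simp: vector_derivative_works)
  have "((\<lambda>t. complex_of_real (t\<^sup>2)) has_vector_derivative of_real (2 * u)) (at u)"
    by (intro has_vector_derivative_of_real) (auto intro!: derivative_eq_intros)
  from has_vector_derivative_divide[OF has_vector_derivative_diff[OF
        has_vector_derivative_mult[OF D this] has_vector_derivative_const]]
  have "((\<lambda>t. (f \<zeta> t * of_real (t\<^sup>2) - C * lg \<zeta>) / \<zeta>) has_vector_derivative
      (f \<zeta> u * of_real (2 * u) + D * of_real (u\<^sup>2)) / \<zeta>) (at u)"
    by (simp only: diff_zero)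
  moreover have "eventually (\<lambda>t. (f \<zeta> t * of_real (t\<^sup>2) - C * lg \<zeta>) / \<zeta> = g t) (nhds u)"
    using slices(2)[OF assms]
  proof eventually_elim
    case (elim t)
    then show ?case using base_D[OF elim] by (simp add: BL13_def field_simps)
  qed
  ultimately have "(g has_vector_derivative
      (f \<zeta> u * of_real (2 * u) + D * of_real (u\<^sup>2)) / \<zeta>) (at u)"
    by (rule has_vector_derivative_transform_nhds)
  then show ?thesis by (rule differentiableI_vector)
qed

text \<open>Without \<open>g\<close> both differentials are multiples of the differential of
  \<open>cmod \<zeta>\<close>.\<close>

lemma wedge_eq_0:
  assumes g0: "\<And>\<zeta> u v. (\<zeta>, u, v) \<in> M \<Longrightarrow> g u = 0" and p: "(\<zeta>, u, v) \<in> M"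
  shows "wedge_d (spin_alpha a) (spin_nu M f a) (\<zeta>, u, v) X Y = 0"
proof -
  define r where "r = complex_of_real (cmod \<zeta>)"
  define k where "k = sgn \<kappa> * of_real (sgn u / cmod C)"
  have nz: "\<zeta> \<noteq> 0" using base_D[OF base_I[OF p]] by simp
  have "((\<lambda>r. k * (2 * r ^ 3 + cnj C * r)) has_field_derivative k * (6 * r\<^sup>2 + cnj C)) (at r)"
    by (auto intro!: derivative_eq_intros)
  note has_derivative_radial[OF nz this[unfolded r_def]]
  then have "(spin_nu M f a has_derivative
      (\<lambda>X. k * (6 * r\<^sup>2 + cnj C) * of_real (fst X \<bullet> sgn \<zeta>))) (at (\<zeta>, u, v))"
    unfolding r_def
    by (rule has_derivative_cong_sgn[OF _ p]) (simp add: spin_nu_eq g0 k_def)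
  from frechet_derivative_at[OF this, symmetric]
    frechet_derivative_at[OF has_derivative_spin_alpha[OF p], symmetric]
  show ?thesis by (simp add: wedge_d_def)
qed

lemma g_eq_0:
  assumes p: "(\<zeta>, u, v) \<in> M"
    and w: "\<And>X Y. wedge_d (spin_alpha a) (spin_nu M f a) (\<zeta>, u, v) X Y = 0"
  shows "g u = 0"
proof -
  define k where "k = sgn \<kappa> * of_real (sgn u / cmod C)"
  have nz: "\<zeta> \<noteq> 0" "u \<noteq> 0" using base_D[OF base_I[OF p]] by auto
  obtain G where G: "(g has_derivative G) (at u)"
    using g_differentiable[OF base_I[OF p]] by (auto simp: differentiable_def)
  have "((\<lambda>x. fst (snd x)) has_derivative (\<lambda>X. fst (snd X))) (at (\<zeta>, u, v))"
    by (auto intro!: derivative_eq_intros)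
  from has_derivative_compose[OF this, of g G] G
  have g: "((\<lambda>x. cnj (g (fst (snd x)))) has_derivative (\<lambda>X. cnj (G (fst (snd X))))) (at (\<zeta>, u, v))"
    by (intro has_derivative_cnj) simp
  have z: "((\<lambda>x. cnj (fst x)) has_derivative (\<lambda>X. cnj (fst X))) (at (\<zeta>, u, v))"
    by (auto intro!: derivative_eq_intros)
  have r: "((\<lambda>x. complex_of_real (cmod (fst x))) has_derivative (\<lambda>X. of_real (fst X \<bullet> sgn \<zeta>)))
      (at (\<zeta>, u, v))"
    by (rule has_derivative_of_real_cmod_fst[OF nz(1)])
  have rad: "((\<lambda>x. 2 * of_real (cmod (fst x)) ^ 3 + cnj C * of_real (cmod (fst x))) has_derivative
      (\<lambda>X. (6 * (of_real (cmod \<zeta>))\<^sup>2 + cnj C) * of_real (fst X \<bullet> sgn \<zeta>))) (at (\<zeta>, u, v))"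
    by (rule has_derivative_radial[OF nz(1), of "\<lambda>r. 2 * r ^ 3 + cnj C * r"])
       (auto intro!: derivative_eq_intros)
  have "((\<lambda>x. k * (2 * of_real (cmod (fst x)) ^ 3 + cnj C * of_real (cmod (fst x))
        + cnj (fst x) * of_real (cmod (fst x)) * cnj (g (fst (snd x))))) has_derivative
      (\<lambda>X. k * ((6 * (of_real (cmod \<zeta>))\<^sup>2 + cnj C) * of_real (fst X \<bullet> sgn \<zeta>)
        + (cnj \<zeta> * of_real (cmod \<zeta>) * cnj (G (fst (snd X)))
          + (cnj \<zeta> * of_real (fst X \<bullet> sgn \<zeta>) + cnj (fst X) * of_real (cmod \<zeta>)) * cnj (g u)))))
      (at (\<zeta>, u, v))"
    using has_derivative_mult_right[OF has_derivative_add[OF rad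
        has_derivative_mult[OF has_derivative_mult[OF z r] g]], of k]
    by (simp only: fst_conv snd_conv)
  note nu = has_derivative_cong_sgn[OF this p, of "spin_nu M f a"]
  have nu: "frechet_derivative (spin_nu M f a) (at (\<zeta>, u, v)) =
      (\<lambda>X. k * ((6 * (of_real (cmod \<zeta>))\<^sup>2 + cnj C) * of_real (fst X \<bullet> sgn \<zeta>)
        + (cnj \<zeta> * of_real (cmod \<zeta>) * cnj (G (fst (snd X)))
          + (cnj \<zeta> * of_real (fst X \<bullet> sgn \<zeta>) + cnj (fst X) * of_real (cmod \<zeta>)) * cnj (g u))))"
    by (rule frechet_derivative_at[OF nu, symmetric]) (simp add: spin_nu_eq k_def)
  have G0: "G 0 = 0" using has_derivative_bounded_linear[OF G] by (rule linear_simps(3))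
  \<comment> \<open>\<open>?X\<close> rotates \<zeta> and is annihilated by the differential of
    \<alpha>; \<open>?Y\<close> is radial and is not. The wedge is thus a nonzero multiple of the
    derivative of \<nu> along \<open>?X\<close>. As \<open>?X\<close> has no
    \<open>u\<close>-component, the derivative \<open>G\<close> enters it only as
    \<open>G 0 = 0\<close>.\<close>
  let ?X = "(\<i> * \<zeta>, 0, 0)" and ?Y = "(\<zeta>, 0, 0)"
  have i: "(\<i> * \<zeta>) \<bullet> sgn \<zeta> = 0" "\<zeta> \<bullet> sgn \<zeta> = cmod \<zeta>"
    using nz by (simp_all add: sgn_div_norm inner_complex_def[of "\<i> * \<zeta>"] dot_square_norm power2_eq_square)
  have "frechet_derivative (spin_nu M f a) (at (\<zeta>, u, v)) ?X
      = k * (- \<i> * cnj \<zeta> * of_real (cmod \<zeta>) * cnj (g u))"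
    unfolding nu by (simp add: i G0)
  moreover have "frechet_derivative (spin_alpha a) (at (\<zeta>, u, v)) ?X = 0"
    "frechet_derivative (spin_alpha a) (at (\<zeta>, u, v)) ?Y \<noteq> 0"
    unfolding frechet_derivative_at[OF has_derivative_spin_alpha[OF p], symmetric]
    using nz \<kappa>_nz by (simp_all add: i sgn_zero_iff)
  ultimately show ?thesis
    using w[of ?X ?Y] nz \<kappa>_nz C by (simp add: wedge_d_def k_def sgn_zero_iff)
qed

end

theorem proposition8p1:
  fixes M :: "point set"
    and C :: complex
    and g :: "real \<Rightarrow> complex"
    and lg :: "complex \<Rightarrow> complex"
    and a L :: "complex \<Rightarrow> real \<Rightarrow> complex"
  assumes "coordinate_domain M"
    and "C \<noteq> 0"
    and "log_branch (fst ` M) lg"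
    and "vacuum_pp_wave M (BL13 lg C g)"
    and "adapted_branches M (BL13 lg C g) a L"
  shows "((\<forall>p\<in>M. \<forall>X Y. wedge_d (spin_alpha a) (spin_nu M (BL13 lg C g) a) p X Y = 0)
            \<longleftrightarrow> (\<forall>p\<in>M. inv_Y M (BL13 lg C g) a L p = 0))
       \<and> ((\<forall>p\<in>M. inv_Y M (BL13 lg C g) a L p = 0)
            \<longleftrightarrow> (\<forall>(\<zeta>, u, v)\<in>M. g u = 0))"
proof -
  interpret BL13_wave M C g lg a L
    by standard (fact assms)+
  have "(\<forall>p\<in>M. inv_Y M f a L p = 0) \<longleftrightarrow> (\<forall>(\<zeta>, u, v)\<in>M. g u = 0)"
    using inv_Y_eq_0_iff by fast
  \<comment> \<open>From right to left, \<open>g\<close> must vanish on all of \<open>M\<close>,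
    because \<nu> is differentiated; the other direction is pointwise.\<close>
  moreover have "(\<forall>p\<in>M. \<forall>X Y. wedge_d (spin_alpha a) (spin_nu M f a) p X Y = 0)
      \<longleftrightarrow> (\<forall>(\<zeta>, u, v)\<in>M. g u = 0)"
    using wedge_eq_0 g_eq_0 by fast
  ultimately show ?thesis by simp
qed

end
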